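(* Let $R=L_{\mathbb F_2}(1,2)$. Given finitely many nonzero elements $a_1,\ldots,a_s\in R$, there are $x\in R$ and nonempty positive words $\eta_1,\ldots,\eta_s$ such that $\eta_i^*a_ix=1$ for every $i$. Moreover, for each $i$ one has the decomposition of right $R$-modules $R=a_ixR\oplus\ker\eta_i^*$, in which the complement $\ker\eta_i^*$ is nonzero and has a finite basis (as a right $R$-module) consisting of positive words.
   Context: $R=L_{\mathbb F_2}(1,2)$ is the binary Leavitt algebra: the unital associative $\mathbb F_2$-algebra generated by $e,f,e^*,f^*$ subject to $e^*e=f^*f=1$, $e^*f=f^*e=0$, $ee^*+ff^*=1$. A positive word is a word in $e,f$ (regarded as an element of $R$; the empty word is $1$). For a positive word $\alpha=c_1\cdots c_h$ put $\alpha^*=c_h^*\cdots c_1^*$. Here $\ker\eta^*=\{z\in R:\eta^*z=0\}$ is the kernel of left multiplication by $\eta^*$, a right ideal of $R$. *)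

theory Defs
  imports "HOL-Library.Poly_Mapping" "HOL-Library.Z2"
begin

section \<open>The free algebra on four generators\<close>

text \<open>
  \<open>Pos c\<close> stands for the letter \<open>c\<close> (that is, $e$ or $f$) and \<open>Star c\<close> for $c^*$.
\<close>

datatype letter = E | F

datatype generator = Pos letter | Star letter

text \<open>
  The convolution product on \<^type>\<open>poly_mapping\<close> uses an additive monoid of exponents.
  Words are wrapped so that concatenation can be installed as this (noncommutative) addition
  without affecting \<^type>\<open>list\<close>; the free algebra is then the monoid algebra of words.
\<close>

datatype gen_word = Word (letters: "generator list")

instantiation gen_word :: monoid_add
begin

definition zero_gen_word :: gen_word where "0 = Word []"

definition plus_gen_word :: "gen_word \<Rightarrow> gen_word \<Rightarrow> gen_word"
  where "u + v = Word (letters u @ letters v)"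

instance
  by standard (simp_all add: zero_gen_word_def plus_gen_word_def)

end

type_synonym 'k free_alg = "gen_word \<Rightarrow>\<^sub>0 'k"

definition free_gen :: "generator \<Rightarrow> 'k::field free_alg"
  where "free_gen g = Poly_Mapping.single (Word [g]) 1"


section \<open>The Leavitt algebra $L_K(1,2)$\<close>

text \<open>The field \<open>K\<close> is the type argument; in particular \<open>bit leavitt\<close> is $L_{\mathbb{F}_2}(1,2)$.\<close>

definition leavitt_relators :: "'k::field free_alg set" where
  "leavitt_relators =
    {free_gen (Star E) * free_gen (Pos E) - 1,
     free_gen (Star F) * free_gen (Pos F) - 1,
     free_gen (Star E) * free_gen (Pos F),
     free_gen (Star F) * free_gen (Pos E),
     free_gen (Pos E) * free_gen (Star E) + free_gen (Pos F) * free_gen (Star F) - 1}"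

text \<open>The two-sided ideal generated by the relators; closure under negation comes from
  replacing the left multiplier by its negative.\<close>

inductive_set leavitt_ideal :: "'k::field free_alg set" where
  zero: "0 \<in> leavitt_ideal"
| gen: "r \<in> leavitt_relators \<Longrightarrow> p * r * q \<in> leavitt_ideal"
| add: "p \<in> leavitt_ideal \<Longrightarrow> q \<in> leavitt_ideal \<Longrightarrow> p + q \<in> leavitt_ideal"

lemma leavitt_ideal_mult_left: "p \<in> leavitt_ideal \<Longrightarrow> x * p \<in> leavitt_ideal"
proof (induction rule: leavitt_ideal.induct)
  case (gen r p q)
  then show ?case using leavitt_ideal.gen[of r "x * p" q] by (simp add: mult.assoc)
qed (auto simp: distrib_left intro: leavitt_ideal.intros)

lemma leavitt_ideal_mult_right: "p \<in> leavitt_ideal \<Longrightarrow> p * x \<in> leavitt_ideal"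
proof (induction rule: leavitt_ideal.induct)
  case (gen r p q)
  then show ?case using leavitt_ideal.gen[of r p "q * x"] by (simp add: mult.assoc)
qed (auto simp: distrib_right intro: leavitt_ideal.intros)

lemma leavitt_ideal_uminus: "p \<in> leavitt_ideal \<Longrightarrow> - p \<in> leavitt_ideal"
  using leavitt_ideal_mult_left[of p "- 1"] by simp

lemma leavitt_ideal_diff:
  "p \<in> leavitt_ideal \<Longrightarrow> q \<in> leavitt_ideal \<Longrightarrow> p - q \<in> leavitt_ideal"
  using leavitt_ideal.add[OF _ leavitt_ideal_uminus] by fastforce

text \<open>
  The class \<^class>\<open>ring_1\<close> demands \<open>0 \<noteq> 1\<close>, so we need that the ideal is proper. This is seen
  from the representation on sequences in which \<open>e\<close> and \<open>f\<close> spread a sequence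
  over the even and the odd positions, and \<open>e\<^sup>*\<close> and \<open>f\<^sup>*\<close> read these positions off.
\<close>

fun gen_act :: "generator \<Rightarrow> (nat \<Rightarrow> 'k::field) \<Rightarrow> nat \<Rightarrow> 'k" where
  "gen_act (Pos c) v n = (if odd n \<longleftrightarrow> c = F then v (n div 2) else 0)"
| "gen_act (Star c) v n = v (if c = F then 2 * n + 1 else 2 * n)"

definition word_act :: "gen_word \<Rightarrow> (nat \<Rightarrow> 'k::field) \<Rightarrow> nat \<Rightarrow> 'k"
  where "word_act w v = foldr gen_act (letters w) v"

definition free_act :: "'k::field free_alg \<Rightarrow> (nat \<Rightarrow> 'k) \<Rightarrow> nat \<Rightarrow> 'k"
  where "free_act p v n = Sum_any (\<lambda>w. Poly_Mapping.lookup p w * word_act w v n)"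

lemma gen_act_add: "gen_act g (\<lambda>n. u n + v n) = (\<lambda>n. gen_act g u n + gen_act g v n)"
  by (cases g) (auto simp: fun_eq_iff)

lemma word_act_add: "word_act w (\<lambda>n. u n + v n) = (\<lambda>n. word_act w u n + word_act w v n)"
proof -
  have "foldr gen_act gs (\<lambda>n. u n + v n)
      = (\<lambda>n. foldr gen_act gs u n + foldr gen_act gs v n)" for gs
    by (induction gs) (simp_all add: gen_act_add)
  then show ?thesis by (simp add: word_act_def)
qed

lemma gen_act_scale: "gen_act g (\<lambda>n. b * v n) = (\<lambda>n. b * gen_act g v n)"
  by (cases g) (auto simp: fun_eq_iff)

lemma word_act_scale: "word_act w (\<lambda>n. b * v n) = (\<lambda>n. b * word_act w v n)"
proof -
  have "foldr gen_act gs (\<lambda>n. b * v n) = (\<lambda>n. b * foldr gen_act gs v n)" for gs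
    by (induction gs) (simp_all add: gen_act_scale)
  then show ?thesis by (simp add: word_act_def)
qed

lemma word_act_zero: "word_act w (\<lambda>n. 0) = (\<lambda>n. 0)"
  using word_act_scale[of w 0] by simp

lemma word_act_word_act: "word_act (u + w) v = word_act u (word_act w v)"
  by (simp add: word_act_def plus_gen_word_def)

lemma finite_free_act_support:
  "finite {w. Poly_Mapping.lookup p w * word_act w v n \<noteq> 0}"
  by (rule finite_subset[OF _ finite_lookup[of p]]) auto

lemma free_act_0: "free_act 0 v = (\<lambda>n. 0)"
  by (simp add: free_act_def fun_eq_iff)

lemma free_act_add: "free_act (p + q) v = (\<lambda>n. free_act p v n + free_act q v n)"
  by (simp add: free_act_def fun_eq_iff lookup_add distrib_right
      Sum_any.distrib[OF finite_free_act_support finite_free_act_support])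

lemma free_act_add_right: "free_act p (\<lambda>n. u n + v n) = (\<lambda>n. free_act p u n + free_act p v n)"
  by (simp add: free_act_def fun_eq_iff word_act_add distrib_left
      Sum_any.distrib[OF finite_free_act_support finite_free_act_support])

lemma free_act_zero_right: "free_act p (\<lambda>n. 0) = (\<lambda>n. 0)"
  by (simp add: free_act_def fun_eq_iff word_act_zero)

lemma free_act_single: "free_act (Poly_Mapping.single w b) v = (\<lambda>n. b * word_act w v n)"
proof
  fix n
  have "Poly_Mapping.lookup (Poly_Mapping.single w b) u * word_act u v n
      = (b * word_act u v n when u = w)" for u
    by (auto simp: lookup_single when_def)
  then show "free_act (Poly_Mapping.single w b) v n = b * word_act w v n"
    by (simp add: free_act_def)
qed

lemma free_act_one: "free_act 1 v = v"
  using free_act_single[of 0 1 v] by (simp add: word_act_def) (simp add: zero_gen_word_def)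

lemma free_alg_induct [case_names zero single add]:
  fixes p :: "'k::field free_alg"
  assumes "P 0" and "\<And>w b. P (Poly_Mapping.single w b)"
    and "\<And>p q. P p \<Longrightarrow> P q \<Longrightarrow> P (p + q)"
  shows "P p"
proof (induction p rule: update_induct)
  case const
  then show ?case using assms(1) by simp
next
  case (update p w b)
  have "Poly_Mapping.update w b p = p + Poly_Mapping.single w b"
    using update(1) by (intro poly_mapping_eqI)
      (auto simp: lookup_update lookup_add lookup_single in_keys_iff when_def)
  then show ?case using assms(2,3) update by simp
qed

lemma free_act_mult: "free_act (p * q) v = free_act p (free_act q v)"
proof (induction p rule: free_alg_induct)
  case (single u)
  show ?case
  proof (induction q rule: free_alg_induct)
    case (single w)
    show ?case by (simp add: mult_single free_act_single word_act_word_act word_act_scale mult.assoc)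
  qed (simp_all add: distrib_left free_act_0 free_act_add free_act_add_right free_act_zero_right)
qed (simp_all add: distrib_right free_act_0 free_act_add)

lemma free_act_diff: "free_act (p - q) v = (\<lambda>n. free_act p v n - free_act q v n)"
  using free_act_add[of "p - q" q v] by (simp add: fun_eq_iff)

lemma free_act_relator: "r \<in> leavitt_relators \<Longrightarrow> free_act r v = (\<lambda>n. 0)"
  unfolding leavitt_relators_def
  by (auto simp: free_act_mult free_act_add free_act_diff free_act_one free_gen_def
      free_act_single word_act_def fun_eq_iff)

lemma free_act_leavitt_ideal: "p \<in> leavitt_ideal \<Longrightarrow> free_act p v = (\<lambda>n. 0)"
  by (induction arbitrary: v rule: leavitt_ideal.induct)
    (simp_all add: free_act_0 free_act_add free_act_mult free_act_relator free_act_zero_right)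

lemma one_notin_leavitt_ideal: "1 \<notin> leavitt_ideal"
  using free_act_leavitt_ideal[of 1 "\<lambda>n. 1"] by (auto simp: free_act_one fun_eq_iff)

definition leavitt_rel :: "'k::field free_alg \<Rightarrow> 'k free_alg \<Rightarrow> bool"
  where "leavitt_rel p q \<longleftrightarrow> p - q \<in> leavitt_ideal"

quotient_type (overloaded) 'k leavitt = "'k::field free_alg" / leavitt_rel
proof (rule equivpI)
  show "reflp leavitt_rel"
    by (auto simp: leavitt_rel_def reflp_def intro: leavitt_ideal.zero)
  show "symp leavitt_rel"
    unfolding leavitt_rel_def symp_def by (metis leavitt_ideal_uminus minus_diff_eq)
  show "transp leavitt_rel"
    unfolding leavitt_rel_def transp_def by (metis leavitt_ideal.add diff_add_cancel add_diff_eq)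
qed

instantiation leavitt :: (field) ring_1
begin

lift_definition zero_leavitt :: "'a leavitt" is 0 .

lift_definition one_leavitt :: "'a leavitt" is 1 .

lift_definition plus_leavitt :: "'a leavitt \<Rightarrow> 'a leavitt \<Rightarrow> 'a leavitt" is "(+)"
  unfolding leavitt_rel_def by (drule (1) leavitt_ideal.add) (simp add: algebra_simps)

lift_definition uminus_leavitt :: "'a leavitt \<Rightarrow> 'a leavitt" is uminus
  unfolding leavitt_rel_def by (drule leavitt_ideal_uminus) simp

lift_definition minus_leavitt :: "'a leavitt \<Rightarrow> 'a leavitt \<Rightarrow> 'a leavitt" is "(-)"
  unfolding leavitt_rel_def by (drule (1) leavitt_ideal_diff) (simp add: algebra_simps)

lift_definition times_leavitt :: "'a leavitt \<Rightarrow> 'a leavitt \<Rightarrow> 'a leavitt" is "(*)"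
proof -
  fix p p' q q' :: "'a free_alg"
  assume "leavitt_rel p p'" "leavitt_rel q q'"
  moreover have "p * q - p' * q' = (p - p') * q + p' * (q - q')"
    by (simp add: algebra_simps)
  ultimately show "leavitt_rel (p * q) (p' * q')"
    unfolding leavitt_rel_def
    by (simp add: leavitt_ideal.add leavitt_ideal_mult_left leavitt_ideal_mult_right)
qed

instance
proof
  show "(0 :: 'a leavitt) \<noteq> 1"
    by transfer (use one_notin_leavitt_ideal leavitt_ideal_uminus in \<open>force simp: leavitt_rel_def\<close>)
qed (transfer; simp add: leavitt_rel_def algebra_simps leavitt_ideal.zero)+

end

lift_definition leavitt_gen :: "generator \<Rightarrow> 'k::field leavitt" is free_gen .

lemma leavitt_relations:
  "leavitt_gen (Star E) * leavitt_gen (Pos E) = (1 :: 'k::field leavitt)"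
  "leavitt_gen (Star F) * leavitt_gen (Pos F) = (1 :: 'k leavitt)"
  "leavitt_gen (Star E) * leavitt_gen (Pos F) = (0 :: 'k leavitt)"
  "leavitt_gen (Star F) * leavitt_gen (Pos E) = (0 :: 'k leavitt)"
  "leavitt_gen (Pos E) * leavitt_gen (Star E) + leavitt_gen (Pos F) * leavitt_gen (Star F)
    = (1 :: 'k leavitt)"
proof -
  have "r \<in> leavitt_relators \<Longrightarrow> r \<in> leavitt_ideal" for r :: "'k free_alg"
    using leavitt_ideal.gen[of r 1 1] by simp
  then show
    "leavitt_gen (Star E) * leavitt_gen (Pos E) = (1 :: 'k leavitt)"
    "leavitt_gen (Star F) * leavitt_gen (Pos F) = (1 :: 'k leavitt)"
    "leavitt_gen (Star E) * leavitt_gen (Pos F) = (0 :: 'k leavitt)"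
    "leavitt_gen (Star F) * leavitt_gen (Pos E) = (0 :: 'k leavitt)"
    "leavitt_gen (Pos E) * leavitt_gen (Star E) + leavitt_gen (Pos F) * leavitt_gen (Star F)
      = (1 :: 'k leavitt)"
    by (transfer; simp add: leavitt_rel_def leavitt_relators_def)+
qed

text \<open>The element $c_1 \cdots c_h$, and its adjoint $c_h^* \cdots c_1^*$.\<close>

definition pos_word :: "letter list \<Rightarrow> 'k::field leavitt"
  where "pos_word \<alpha> = prod_list (map (\<lambda>c. leavitt_gen (Pos c)) \<alpha>)"

definition pos_word_star :: "letter list \<Rightarrow> 'k::field leavitt"
  where "pos_word_star \<alpha> = prod_list (map (\<lambda>c. leavitt_gen (Star c)) (rev \<alpha>))"


section \<open>Right modules inside a noncommutative ring\<close>

text \<open>The module locales of the library require a commutative ring, hence the following notions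
  for right submodules of the regular right module.\<close>

definition right_submodule :: "'a::ring_1 set \<Rightarrow> bool" where
  "right_submodule M \<longleftrightarrow>
    0 \<in> M \<and> (\<forall>x\<in>M. \<forall>y\<in>M. x + y \<in> M) \<and> (\<forall>x\<in>M. \<forall>r. x * r \<in> M)"

definition right_direct_sum :: "'a::ring_1 set \<Rightarrow> 'a set \<Rightarrow> 'a set \<Rightarrow> bool" where
  "right_direct_sum M U V \<longleftrightarrow>
    right_submodule U \<and> right_submodule V \<and> M = {u + v | u v. u \<in> U \<and> v \<in> V} \<and> U \<inter> V = {0}"

definition right_multiples :: "'a::ring_1 \<Rightarrow> 'a set"
  where "right_multiples a = {a * r | r. True}"

definition ker_left_mult :: "'a::ring_1 \<Rightarrow> 'a set"
  where "ker_left_mult a = {z. a * z = 0}"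

definition right_span :: "'a::ring_1 set \<Rightarrow> 'a set"
  where "right_span B = {\<Sum>b\<in>T. b * c b | T c. finite T \<and> T \<subseteq> B}"

definition right_independent :: "'a::ring_1 set \<Rightarrow> bool" where
  "right_independent B \<longleftrightarrow>
    (\<forall>T c. finite T \<longrightarrow> T \<subseteq> B \<longrightarrow> (\<Sum>b\<in>T. b * c b) = 0 \<longrightarrow> (\<forall>b\<in>T. c b = 0))"

definition right_basis :: "'a::ring_1 set \<Rightarrow> 'a set \<Rightarrow> bool"
  where "right_basis M B \<longleftrightarrow> right_independent B \<and> right_span B = M"

end

theory Submission
  imports Defs
begin

text \<open>
  If \<open>n\<close> is large, then \<open>a\<^sub>i \<gamma>\<close> is, for every \<open>i\<close> and every positive word \<open>\<gamma>\<close> of length \<open>n\<close>,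
  a sum of distinct positive words, and since $\sum_{|\gamma| = n} \gamma\gamma^* = 1$ this
  sum is nonempty for some \<open>\<gamma>\<close>. Adding up the words \<open>\<gamma> w\<^sub>\<gamma>\<close> with \<open>w\<^sub>\<gamma>\<close> of
  rapidly growing lengths gives one \<open>y\<close> for which all \<open>a\<^sub>i y\<close> are nonempty sums of distinct
  positive words. If \<open>\<alpha>\<^sub>i\<close> is a shortest word in \<open>a\<^sub>i y\<close> and \<open>\<tau> = e f\<^sup>M\<close> with \<open>M\<close> large,
  then \<open>\<alpha>\<^sub>i \<tau>\<close> is not a prefix of any other \<open>\<beta> \<tau>\<close> with \<open>\<beta>\<close> in \<open>a\<^sub>i y\<close>, because \<open>\<tau>\<close> overlaps
  itself only trivially. Hence \<open>x = y \<tau>\<close> and \<open>\<eta>\<^sub>i = \<alpha>\<^sub>i \<tau>\<close> work. The kernel of $\eta^*$ has as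
  basis the words other than \<open>\<eta>\<close> of the same length.
\<close>

section \<open>Positive words and their adjoints: orthogonality and completeness\<close>

lemma finite_UNIV_letter: "finite (UNIV :: letter set)"
proof -
  have "(UNIV :: letter set) = {E, F}" using letter.exhaust by auto
  then show ?thesis by (metis finite.emptyI finite_insert)
qed

lemma finite_letter_lists: "finite {\<gamma> :: letter list. length \<gamma> = n}"
  using finite_lists_length_eq[of "UNIV :: letter set" n] by (simp add: finite_UNIV_letter)

lemma pos_word_simps:
  "pos_word [] = 1"
  "pos_word (c # \<alpha>) = leavitt_gen (Pos c) * pos_word \<alpha>"
  "pos_word (\<alpha> @ \<beta>) = pos_word \<alpha> * pos_word \<beta>"
  by (simp_all add: pos_word_def)

lemma pos_word_star_simps:
  "pos_word_star [] = 1"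
  "pos_word_star (c # \<alpha>) = pos_word_star \<alpha> * leavitt_gen (Star c)"
  "pos_word_star (\<alpha> @ \<beta>) = pos_word_star \<beta> * pos_word_star \<alpha>"
  by (simp_all add: pos_word_star_def)

lemma star_gen_mult_pos_gen:
  "leavitt_gen (Star c) * leavitt_gen (Pos d) = (if c = d then 1 else 0)"
  by (cases c; cases d) (simp_all add: leavitt_relations)

lemma pos_word_star_mult_pos_word_append: 
  "pos_word_star \<alpha> * pos_word (\<alpha> @ \<beta>) = (pos_word \<beta> :: 'k::field leavitt)"
proof (induction \<alpha>)
  case (Cons c \<alpha>)
  have "pos_word_star (c # \<alpha>) * pos_word ((c # \<alpha>) @ \<beta>)
      = pos_word_star \<alpha> * (leavitt_gen (Star c) * leavitt_gen (Pos c)) * (pos_word (\<alpha> @ \<beta>) :: 'k leavitt)"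
    by (simp only: append_Cons pos_word_simps pos_word_star_simps mult.assoc)
  with Cons show ?case by (simp add: star_gen_mult_pos_gen)
qed (simp add: pos_word_star_simps)

text \<open>Equal letters cancel from the front until the first mismatch, which gives 0. The length
  bound excludes that \<beta> is a proper prefix of \<alpha>, where a starred word would be left
  over.\<close>

lemma pos_word_star_mult_pos_word_eq_0:
  assumes "length \<alpha> \<le> length \<beta>" and "\<nexists>\<delta>. \<beta> = \<alpha> @ \<delta>"
  shows "pos_word_star \<alpha> * pos_word \<beta> = (0 :: 'k::field leavitt)"
  using assms
proof (induction \<alpha> arbitrary: \<beta>)
  case (Cons c \<alpha>)
  then obtain d \<beta>' where \<beta>: "\<beta> = d # \<beta>'" by (cases \<beta>) auto
  have *: "pos_word_star (c # \<alpha>) * pos_word \<beta>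
      = pos_word_star \<alpha> * (leavitt_gen (Star c) * leavitt_gen (Pos d)) * (pos_word \<beta>' :: 'k leavitt)"
    by (simp only: \<beta> pos_word_simps pos_word_star_simps mult.assoc)
  show ?case
  proof (cases "c = d")
    case True
    then show ?thesis
      using Cons.IH[of \<beta>'] Cons.prems unfolding * by (simp add: \<beta> star_gen_mult_pos_gen)
  qed (simp add: * star_gen_mult_pos_gen)
qed simp

lemma pos_word_star_mult_pos_word_same_length:
  assumes "length \<alpha> = length \<beta>"
  shows "pos_word_star \<alpha> * pos_word \<beta> = (if \<alpha> = \<beta> then 1 else 0 :: 'k::field leavitt)"
proof (cases "\<alpha> = \<beta>")
  case True
  then show ?thesis
    using pos_word_star_mult_pos_word_append[of \<alpha> "[]", where 'k = 'k]
    by (simp add: pos_word_simps)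
next
  case False
  with assms show ?thesis by (auto intro!: pos_word_star_mult_pos_word_eq_0)
qed

text \<open>Orthogonality separates words of equal length. This lets sums over sets of ring
  elements, as in \<open>right_span\<close> and \<open>right_independent\<close>, be reindexed by
  words.\<close>

lemma inj_on_pos_word: "inj_on (pos_word :: _ \<Rightarrow> 'k::field leavitt) {\<gamma>. length \<gamma> = n}"
proof (rule inj_onI)
  fix \<alpha> \<beta> :: "letter list"
  assume len: "\<alpha> \<in> {\<gamma>. length \<gamma> = n}" "\<beta> \<in> {\<gamma>. length \<gamma> = n}"
    and "pos_word \<alpha> = (pos_word \<beta> :: 'k leavitt)"
  then have "pos_word_star \<alpha> * pos_word \<beta> = (1 :: 'k leavitt)"
    using pos_word_star_mult_pos_word_same_length[of \<alpha> \<alpha>, where 'k = 'k] by simp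
  then show "\<alpha> = \<beta>"
    using len by (auto simp: pos_word_star_mult_pos_word_same_length split: if_splits)
qed

text \<open>Splitting by the first letter leaves the sum for n between \<open>Pos c\<close> and
  \<open>Star c\<close>; it is 1 by induction, and the last relation adds up the two
  letters.\<close>

lemma sum_pos_word_mult_pos_word_star:
  "(\<Sum>\<gamma> | length \<gamma> = n. pos_word \<gamma> * pos_word_star \<gamma>) = (1 :: 'k::field leavitt)"
proof (induction n)
  case 0
  then show ?case by (simp add: pos_word_simps pos_word_star_simps)
next
  case (Suc n)
  let ?G = "{\<gamma> :: letter list. length \<gamma> = n}"
  let ?t = "\<lambda>\<gamma>. pos_word \<gamma> * pos_word_star \<gamma> :: 'k leavitt"
  have cons: "(\<Sum>\<gamma>\<in>Cons c ` ?G. ?t \<gamma>) = leavitt_gen (Pos c) * leavitt_gen (Star c)" for c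
  proof -
    have "(\<Sum>\<gamma>\<in>Cons c ` ?G. ?t \<gamma>) = (\<Sum>\<gamma>\<in>?G. leavitt_gen (Pos c) * ?t \<gamma> * leavitt_gen (Star c))"
      by (subst sum.reindex) (auto simp: pos_word_simps pos_word_star_simps mult.assoc)
    also have "\<dots> = leavitt_gen (Pos c) * (\<Sum>\<gamma>\<in>?G. ?t \<gamma>) * leavitt_gen (Star c)"
      by (simp add: sum_distrib_left sum_distrib_right)
    finally show ?thesis using Suc by simp
  qed
  have "{\<gamma>. length \<gamma> = Suc n} = Cons E ` ?G \<union> Cons F ` ?G"
    by (auto simp: length_Suc_conv image_iff intro: letter.exhaust)
  then have "(\<Sum>\<gamma> | length \<gamma> = Suc n. ?t \<gamma>) = (\<Sum>\<gamma>\<in>Cons E ` ?G. ?t \<gamma>) + (\<Sum>\<gamma>\<in>Cons F ` ?G. ?t \<gamma>)"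
    by (simp, intro sum.union_disjoint) (auto simp: finite_letter_lists)
  then show ?case by (simp add: cons leavitt_relations)
qed

lemma eq_sum_pos_word:
  "z = (\<Sum>\<gamma> | length \<gamma> = n. pos_word \<gamma> * (pos_word_star \<gamma> * (z :: 'k::field leavitt)))"
proof -
  have "z = (\<Sum>\<gamma> | length \<gamma> = n. pos_word \<gamma> * pos_word_star \<gamma>) * z"
    by (simp add: sum_pos_word_mult_pos_word_star)
  then show ?thesis by (simp add: sum_distrib_right mult.assoc)
qed

section \<open>The kernel of a starred word\<close>

lemma right_submodule_right_multiples: "right_submodule (right_multiples a)"
  unfolding right_submodule_def right_multiples_def
  by (auto simp: mult.assoc intro: exI[of _ 0] simp flip: distrib_left)

lemma right_submodule_ker_left_mult: "right_submodule (ker_left_mult a)"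
  unfolding right_submodule_def ker_left_mult_def
  by (simp add: distrib_left flip: mult.assoc)

text \<open>Since u * v = 1, the element v * u is idempotent; left multiplication by it projects
  onto the multiples of v and has the kernel of u as its kernel.\<close>

lemma right_direct_sum_ker_left_mult:
  assumes "u * v = 1"
  shows "right_direct_sum UNIV (right_multiples v) (ker_left_mult u)"
proof -
  have uv: "u * (v * r) = r" for r
    using assms by (simp flip: mult.assoc)
  have "z = v * (u * z) + (z - v * (u * z)) \<and> z - v * (u * z) \<in> ker_left_mult u" for z
    by (simp add: ker_left_mult_def right_diff_distrib uv)
  then have "UNIV = {y + z | y z. y \<in> right_multiples v \<and> z \<in> ker_left_mult u}"
    unfolding right_multiples_def by blast
  moreover have "right_multiples v \<inter> ker_left_mult u = {0}"
    using right_submodule_right_multiples[of v] right_submodule_ker_left_mult[of u]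
    by (auto simp: right_multiples_def ker_left_mult_def uv right_submodule_def)
  ultimately show ?thesis
    by (simp add: right_direct_sum_def right_submodule_right_multiples right_submodule_ker_left_mult)
qed

text \<open>Left multiplication by the adjoint of one word of length n kills all the others and so
  extracts the coefficient at that word.\<close>

lemma right_independent_pos_words:
  "right_independent (pos_word ` {\<gamma>. length \<gamma> = n} :: 'k::field leavitt set)"
  unfolding right_independent_def
proof (intro allI impI ballI)
  fix T and c :: "'k leavitt \<Rightarrow> 'k leavitt" and b
  assume T: "finite T" "T \<subseteq> pos_word ` {\<gamma>. length \<gamma> = n}"
    and sum: "(\<Sum>b\<in>T. b * c b) = 0" and b: "b \<in> T"
  from T b obtain \<beta> where \<beta>: "b = pos_word \<beta>" "length \<beta> = n" by auto
  have orth: "pos_word_star \<beta> * b' = (if b' = b then 1 else 0)" if "b' \<in> T" for b'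
  proof -
    from that T obtain \<gamma> where "b' = pos_word \<gamma>" "length \<gamma> = n" by auto
    with \<beta> show ?thesis
      using inj_on_eq_iff[OF inj_on_pos_word[where 'k = 'k], of \<beta> n \<gamma>]
      by (auto simp: pos_word_star_mult_pos_word_same_length)
  qed
  have "0 = pos_word_star \<beta> * (\<Sum>b\<in>T. b * c b)" by (simp add: sum)
  also have "\<dots> = (\<Sum>b'\<in>T. if b' = b then c b' else 0)"
    unfolding sum_distrib_left mult.assoc[symmetric] by (rule sum.cong) (simp_all add: orth)
  also have "\<dots> = c b" using b T(1) by simp
  finally show "c b = 0" by simp
qed

lemma right_independent_subset: "right_independent B \<Longrightarrow> A \<subseteq> B \<Longrightarrow> right_independent A"
  unfolding right_independent_def by (meson subset_trans)

text \<open>In the expansion \<open>eq_sum_pos_word\<close> at the length of \<eta>, the coefficient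
  at \<eta> is exactly what vanishes for z in the kernel.\<close>

lemma right_basis_ker_pos_word_star:
  "right_basis (ker_left_mult (pos_word_star \<eta>))
    (pos_word ` ({\<gamma>. length \<gamma> = length \<eta>} - {\<eta>}) :: 'k::field leavitt set)"
  (is "right_basis ?K (pos_word ` ?G)")
proof -
  let ?B = "pos_word ` ?G :: 'k leavitt set"
  have inj: "inj_on (pos_word :: _ \<Rightarrow> 'k leavitt) ?G"
    using inj_on_pos_word by (rule inj_on_subset) auto
  have "pos_word_star \<eta> * b = 0" if "b \<in> ?B" for b
    using that by (auto simp: pos_word_star_mult_pos_word_same_length split: if_splits)
  then have "pos_word_star \<eta> * (\<Sum>b\<in>T. b * c b) = 0" if "T \<subseteq> ?B" for T c
    using that unfolding sum_distrib_left mult.assoc[symmetric]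
    by (intro sum.neutral ballI) (simp add: subset_iff)
  then have "right_span ?B \<subseteq> ?K"
    unfolding right_span_def ker_left_mult_def by clarsimp
  moreover have "z \<in> right_span ?B" if z: "z \<in> ?K" for z
  proof -
    have "z = (\<Sum>\<gamma> | length \<gamma> = length \<eta>. pos_word \<gamma> * (pos_word_star \<gamma> * z))"
      by (rule eq_sum_pos_word)
    also have "\<dots> = (\<Sum>\<gamma>\<in>?G. pos_word \<gamma> * (pos_word_star \<gamma> * z))"
      using z by (intro sum.mono_neutral_right) (auto simp: finite_letter_lists ker_left_mult_def)
    \<comment> \<open>Coefficients in \<open>right_span\<close> are indexed by ring elements, so
      each word is recovered by inverting \<open>pos_word\<close> on \<open>?G\<close>.\<close>
    also have "\<dots> = (\<Sum>b\<in>?B. b * (pos_word_star (inv_into ?G pos_word b) * z))"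
      by (subst sum.reindex[OF inj], rule sum.cong) (simp_all only: o_apply inv_into_f_f[OF inj])
    finally have "z = (\<Sum>b\<in>?B. b * (pos_word_star (inv_into ?G pos_word b) * z))" .
    moreover have "finite ?B" by (simp add: finite_letter_lists)
    ultimately show ?thesis
      unfolding right_span_def
      by (intro CollectI exI[of _ ?B] exI[of _ "\<lambda>b. pos_word_star (inv_into ?G pos_word b) * z"]) simp
  qed
  moreover have "right_independent ?B"
    using right_independent_pos_words by (rule right_independent_subset) (rule image_mono[OF Diff_subset])
  ultimately show ?thesis
    by (simp add: right_basis_def subset_antisym subsetI)
qed

text \<open>Changing the first letter of \<eta> gives a word of the same length, hence a nonzero
  element of the kernel.\<close>

lemma ker_pos_word_star_nonzero:
  assumes "\<eta> \<noteq> []"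
  shows "ker_left_mult (pos_word_star \<eta>) \<noteq> {0 :: 'k::field leavitt}"
proof -
  obtain c \<eta>' where \<eta>: "\<eta> = c # \<eta>'" using assms by (cases \<eta>) auto
  obtain d where "d \<noteq> c" using letter.distinct by metis
  then have "pos_word (d # \<eta>') \<in> ker_left_mult (pos_word_star \<eta> :: 'k leavitt)"
    by (simp add: ker_left_mult_def pos_word_star_mult_pos_word_same_length \<eta>)
  moreover have "pos_word (d # \<eta>') \<noteq> (0 :: 'k leavitt)"
    using pos_word_star_mult_pos_word_same_length[of "d # \<eta>'" "d # \<eta>'", where 'k = 'k]
    by auto
  ultimately show ?thesis by blast
qed

section \<open>Sums of positive words\<close>

text \<open>Over $\mathbb{F}_2$ these are the elements of the subalgebra generated by \<open>e\<close> and \<open>f\<close>.\<close>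

definition positive_sum :: "letter list set \<Rightarrow> bit leavitt"
  where "positive_sum S = (\<Sum>\<alpha>\<in>S. pos_word \<alpha>)"

definition positive_sums :: "bit leavitt set"
  where "positive_sums = positive_sum ` Collect finite"

lemma bit_leavitt_double: "x + x = (0 :: bit leavitt)"
proof -
  have "p + p = 0" for p :: "bit free_alg"
    by (rule poly_mapping_eqI) (simp add: lookup_add)
  then show ?thesis by transfer (simp add: leavitt_rel_def leavitt_ideal.zero)
qed

text \<open>In characteristic 2 the common words cancel, so the sum belongs to the symmetric
  difference of the two sets.\<close>

lemma positive_sums_add:
  assumes "x \<in> positive_sums" "y \<in> positive_sums"
  shows "x + y \<in> positive_sums"
proof -
  from assms obtain S T where S: "finite S" "x = positive_sum S" and T: "finite T" "y = positive_sum T"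
    by (auto simp: positive_sums_def)
  have 1: "positive_sum S = positive_sum (S - T) + positive_sum (S \<inter> T)"
    unfolding positive_sum_def using S(1) sum.Int_Diff[of S _ T] by (simp add: add.commute)
  have 2: "positive_sum T = positive_sum (T - S) + positive_sum (S \<inter> T)"
    unfolding positive_sum_def using T(1) sum.Int_Diff[of T _ S] by (simp add: add.commute Int_commute)
  have 3: "positive_sum (S - T \<union> (T - S)) = positive_sum (S - T) + positive_sum (T - S)"
    unfolding positive_sum_def using S(1) T(1) by (intro sum.union_disjoint) auto
  have "x + y = positive_sum (S - T) + positive_sum (T - S) + (positive_sum (S \<inter> T) + positive_sum (S \<inter> T))"
    by (simp add: S(2) T(2) 1 2 ac_simps)
  also have "\<dots> = positive_sum (S - T \<union> (T - S))"
    by (simp add: 3 bit_leavitt_double)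
  finally show ?thesis using S(1) T(1) by (auto simp: positive_sums_def)
qed

lemma zero_in_positive_sums: "0 \<in> positive_sums"
  unfolding positive_sums_def by (rule image_eqI[of _ _ "{}"]) (auto simp: positive_sum_def)

lemma pos_word_in_positive_sums: "pos_word \<alpha> \<in> positive_sums"
  unfolding positive_sums_def by (rule image_eqI[of _ _ "{\<alpha>}"]) (auto simp: positive_sum_def)

text \<open>The rightmost generator acts first: an unstarred one lengthens the word, a starred one
  strips its first letter or gives 0. The length bound ensures that a starred generator always meets
  a letter.\<close>

lemma generators_mult_long_pos_word:
  assumes "length gs \<le> length \<gamma>"
  shows "prod_list (map leavitt_gen gs) * pos_word \<gamma> \<in> insert (0 :: 'k::field leavitt) (range pos_word)"
  using assms
proof (induction gs arbitrary: \<gamma> rule: rev_induct)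
  case (snoc g gs)
  show ?case
  proof (cases g)
    case (Pos c)
    then show ?thesis
      using snoc.IH[of "c # \<gamma>"] snoc.prems by (simp add: pos_word_simps mult.assoc)
  next
    case (Star c)
    obtain d \<gamma>' where \<gamma>: "\<gamma> = d # \<gamma>'" using snoc.prems by (cases \<gamma>) auto
    have "prod_list (map leavitt_gen (gs @ [g])) * (pos_word \<gamma> :: 'k leavitt)
        = prod_list (map leavitt_gen gs) * (leavitt_gen (Star c) * leavitt_gen (Pos d)) * pos_word \<gamma>'"
      by (simp add: \<gamma> Star pos_word_simps mult.assoc)
    then show ?thesis
      using snoc.IH[of \<gamma>'] snoc.prems by (simp add: \<gamma> Star star_gen_mult_pos_gen)
  qed
qed simp

lemma abs_leavitt_single_Word:
  "abs_leavitt (Poly_Mapping.single (Word gs) 1) = (prod_list (map leavitt_gen gs) :: 'k::field leavitt)"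
proof (induction gs)
  case Nil
  then show ?case by (simp add: one_leavitt.abs_eq flip: zero_gen_word_def)
next
  case (Cons g gs)
  have "Poly_Mapping.single (Word (g # gs)) 1 = free_gen g * (Poly_Mapping.single (Word gs) 1 :: 'k free_alg)"
    by (simp add: free_gen_def mult_single plus_gen_word_def)
  then show ?case using Cons by (simp add: leavitt_gen.abs_eq flip: times_leavitt.abs_eq)
qed

lemma eventually_mult_pos_word_in_positive_sums:
  fixes a :: "bit leavitt"
  shows "\<forall>\<^sub>F n in sequentially. \<forall>\<gamma>. length \<gamma> = n \<longrightarrow> a * pos_word \<gamma> \<in> positive_sums"
proof (induction a rule: leavitt.abs_induct)
  case (1 p)
  show ?case
  proof (induction p rule: free_alg_induct)
    case zero
    then show ?case by (simp add: zero_in_positive_sums flip: zero_leavitt.abs_eq)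
  next
    case (single w b)
    obtain gs where w: "w = Word gs" by (cases w)
    show ?case
    \<comment> \<open>Over the two-element field a monomial is either 0 or a plain product of
      generators.\<close>
    proof (cases b)
      case zero
      then show ?thesis by (simp add: zero_in_positive_sums flip: zero_leavitt.abs_eq)
    next
      case one
      show ?thesis
        using eventually_ge_at_top[of "length gs"]
      proof eventually_elim
        case (elim n)
        then show ?case
          using generators_mult_long_pos_word[where 'k = bit]
            zero_in_positive_sums pos_word_in_positive_sums
          by (fastforce simp: w one abs_leavitt_single_Word)
      qed
    qed
  next
    case (add p q)
    then show ?case
      by eventually_elim (simp add: distrib_right positive_sums_add flip: plus_leavitt.abs_eq)
  qed
qed

section \<open>One multiplier for finitely many elements\<close>

lemma exists_common_positive_multiplier:
  fixes a :: "'i \<Rightarrow> bit leavitt"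
  assumes "finite I" and nz: "\<And>i. i \<in> I \<Longrightarrow> a i \<noteq> 0"
  shows "\<exists>x. \<forall>i\<in>I. \<exists>S. finite S \<and> S \<noteq> {} \<and> a i * x = positive_sum S"
proof -
  have "\<forall>\<^sub>F n in sequentially. \<forall>i\<in>I. \<forall>\<gamma>. length \<gamma> = n \<longrightarrow> a i * pos_word \<gamma> \<in> positive_sums"
    using assms(1) eventually_mult_pos_word_in_positive_sums by (intro eventually_ball_finite) auto
  then obtain n where n: "\<And>i \<gamma>. i \<in> I \<Longrightarrow> length \<gamma> = n \<Longrightarrow> a i * pos_word \<gamma> \<in> positive_sums"
    by (auto simp: eventually_sequentially)
  define G where "G = {\<gamma> :: letter list. length \<gamma> = n}"
  have finG: "finite G" by (simp add: G_def finite_letter_lists)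
  have "\<exists>S. finite S \<and> a i * pos_word \<gamma> = positive_sum S" if "i \<in> I" "\<gamma> \<in> G" for i \<gamma>
    using n that by (auto simp: G_def positive_sums_def image_iff)
  then obtain S where S: "\<And>i \<gamma>. i \<in> I \<Longrightarrow> \<gamma> \<in> G \<Longrightarrow> finite (S i \<gamma>)"
      "\<And>i \<gamma>. i \<in> I \<Longrightarrow> \<gamma> \<in> G \<Longrightarrow> a i * pos_word \<gamma> = positive_sum (S i \<gamma>)"
    by metis
  have "finite (length ` (\<Union>i\<in>I. \<Union>\<gamma>\<in>G. S i \<gamma>))"
    using assms(1) finG S(1) by blast
  then obtain D where "\<forall>l\<in>length ` (\<Union>i\<in>I. \<Union>\<gamma>\<in>G. S i \<gamma>). l < D"
    using finite_nat_set_iff_bounded by blast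
  then have D: "length \<alpha> < D" if "i \<in> I" "\<gamma> \<in> G" "\<alpha> \<in> S i \<gamma>" for i \<gamma> \<alpha>
    using that by auto
  obtain k :: "letter list \<Rightarrow> nat" where k: "inj_on k G"
    using finite_imp_inj_to_nat_seg[OF finG] by auto
  \<comment> \<open>All words in the sets \<open>S i \<gamma>\<close> are shorter than D, so
    dividing the length of \<alpha> @ w \<gamma> by D returns k \<gamma>, which determines \<gamma>.
    Thus no cancellation occurs between different \<gamma>.\<close>
  define w where "w \<gamma> = replicate (k \<gamma> * D) E" for \<gamma>
  define x :: "bit leavitt" where "x = (\<Sum>\<gamma>\<in>G. pos_word (\<gamma> @ w \<gamma>))"
  have "\<exists>S. finite S \<and> S \<noteq> {} \<and> a i * x = positive_sum S" if i: "i \<in> I" for i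
  proof -
    let ?P = "SIGMA \<gamma>:G. S i \<gamma>"
    let ?h = "\<lambda>(\<gamma>, \<alpha>). \<alpha> @ w \<gamma>"
    have inj: "inj_on ?h ?P"
    proof (rule inj_onI, clarify)
      fix \<gamma> \<alpha> \<gamma>' \<alpha>'
      assume *: "\<gamma> \<in> G" "\<alpha> \<in> S i \<gamma>" "\<gamma>' \<in> G" "\<alpha>' \<in> S i \<gamma>'" and eq: "\<alpha> @ w \<gamma> = \<alpha>' @ w \<gamma>'"
      have lt: "length \<alpha> < D" "length \<alpha>' < D" using D i * by blast+
      have "length \<alpha> + k \<gamma> * D = length \<alpha>' + k \<gamma>' * D"
        using arg_cong[OF eq, of length] by (simp add: w_def)
      then have "(length \<alpha> + k \<gamma> * D) div D = (length \<alpha>' + k \<gamma>' * D) div D" by simp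
      then have "k \<gamma> = k \<gamma>'" using lt by simp
      then have "\<gamma> = \<gamma>'" using k * by (auto dest: inj_onD)
      with eq show "\<gamma> = \<gamma>' \<and> \<alpha> = \<alpha>'" by simp
    qed
    have "a i * x = (\<Sum>\<gamma>\<in>G. a i * pos_word \<gamma> * pos_word (w \<gamma>))"
      by (simp add: x_def sum_distrib_left pos_word_simps mult.assoc)
    also have "\<dots> = (\<Sum>\<gamma>\<in>G. \<Sum>\<alpha>\<in>S i \<gamma>. pos_word (\<alpha> @ w \<gamma>))"
      using i by (intro sum.cong) (simp_all add: S positive_sum_def sum_distrib_right pos_word_simps)
    also have "\<dots> = (\<Sum>p\<in>?P. pos_word (?h p))"
      using finG S(1) i by (simp add: sum.Sigma case_prod_unfold)
    also have "\<dots> = positive_sum (?h ` ?P)"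
      using inj by (simp add: positive_sum_def sum.reindex)
    finally have "a i * x = positive_sum (?h ` ?P)" .
    moreover have "finite ?P" using finG S(1) i by auto
    moreover have "?P \<noteq> {}"
    proof
      \<comment> \<open>Otherwise a i kills every word of length n, and completeness forces a i =
        0.\<close>
      assume "?P = {}"
      then have "S i \<gamma> = {}" if "\<gamma> \<in> G" for \<gamma> using that by blast
      then have "a i * pos_word \<gamma> = 0" if "\<gamma> \<in> G" for \<gamma>
        using S(2)[OF i that] that by (simp add: positive_sum_def)
      then have "a i * (\<Sum>\<gamma> | length \<gamma> = n. pos_word \<gamma> * pos_word_star \<gamma>) = 0"
        by (simp add: sum_distrib_left G_def flip: mult.assoc)
      then show False using nz i by (simp add: sum_pos_word_mult_pos_word_star)
    qed
    ultimately show ?thesis by blast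
  qed
  then show ?thesis by blast
qed

lemma positive_sum_left_inverse:
  assumes "finite S" "S \<noteq> {}" and M: "\<And>\<alpha>. \<alpha> \<in> S \<Longrightarrow> length \<alpha> \<le> M"
  defines "\<tau> \<equiv> E # replicate M F"
  shows "\<exists>\<alpha>. pos_word_star (\<alpha> @ \<tau>) * (positive_sum S * pos_word \<tau>) = 1"
proof -
  \<comment> \<open>Minimal length makes \<alpha> @ \<tau> no longer than any \<beta> @ \<tau>, as
    the vanishing lemma requires, and keeps the subtraction defining l below from
    truncating.\<close>
  obtain \<alpha> where \<alpha>: "\<alpha> \<in> S" "\<And>\<beta>. \<beta> \<in> S \<Longrightarrow> length \<alpha> \<le> length \<beta>"
    using ex_min_if_finite[of "length ` S"] assms(1,2) by (auto simp: not_less)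
  have "pos_word_star (\<alpha> @ \<tau>) * pos_word (\<beta> @ \<tau>) = (if \<beta> = \<alpha> then 1 else 0 :: bit leavitt)"
    if \<beta>: "\<beta> \<in> S" for \<beta>
  proof (cases "\<beta> = \<alpha>")
    case False
    have "\<nexists>\<delta>. \<beta> @ \<tau> = (\<alpha> @ \<tau>) @ \<delta>"
    proof
      assume "\<exists>\<delta>. \<beta> @ \<tau> = (\<alpha> @ \<tau>) @ \<delta>"
      then obtain \<delta> where eq: "\<beta> @ \<tau> = \<alpha> @ \<tau> @ \<delta>" by auto
      define l where "l = length \<beta> - length \<alpha>"
      have l: "length \<beta> = length \<alpha> + l" "l \<le> M"
        using \<alpha>(2)[OF \<beta>] M[OF \<beta>] by (auto simp: l_def)
      have "l \<noteq> 0"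
      proof
        assume "l = 0"
        then have "length \<beta> = length \<alpha>" using l by simp
        with eq have "\<beta> = \<alpha>" by simp
        with False show False ..
      qed
      \<comment> \<open>Position \<open>length \<beta>\<close> is compared on both sides: on the
        left the initial E of \<tau> stands there, on the right the entry l of \<tau>, which lies in
        the block of F because 1 \<le> l \<le> M.\<close>
      have "E = (\<beta> @ \<tau>) ! length \<beta>" by (simp add: \<tau>_def nth_append)
      also have "\<dots> = (\<tau> @ \<delta>) ! l" by (simp add: eq l nth_append)
      also have "\<dots> = F" using \<open>l \<noteq> 0\<close> l(2) by (auto simp: \<tau>_def nth_append nth_Cons')
      finally show False by simp
    qed
    then show ?thesis
      using False \<alpha>(2)[OF \<beta>] by (simp add: pos_word_star_mult_pos_word_eq_0)
  qed (simp add: pos_word_star_mult_pos_word_same_length)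
  then have "pos_word_star (\<alpha> @ \<tau>) * (positive_sum S * pos_word \<tau>) = (\<Sum>\<beta>\<in>S. if \<beta> = \<alpha> then 1 else 0)"
    unfolding positive_sum_def sum_distrib_left sum_distrib_right pos_word_simps(3)[symmetric]
    by (rule sum.cong[OF refl])
  also have "\<dots> = 1" using \<alpha>(1) assms(1) by simp
  finally show ?thesis by blast
qed

lemma exists_common_right_multiplier:
  fixes a :: "'i \<Rightarrow> bit leavitt"
  assumes "finite I" and "\<And>i. i \<in> I \<Longrightarrow> a i \<noteq> 0"
  shows "\<exists>x \<eta>. \<forall>i\<in>I. \<eta> i \<noteq> [] \<and> pos_word_star (\<eta> i) * a i * x = 1"
proof -
  obtain y where "\<forall>i\<in>I. \<exists>S. finite S \<and> S \<noteq> {} \<and> a i * y = positive_sum S"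
    using exists_common_positive_multiplier[of I a] assms by blast
  then obtain S where S: "\<And>i. i \<in> I \<Longrightarrow> finite (S i)" "\<And>i. i \<in> I \<Longrightarrow> S i \<noteq> {}"
      "\<And>i. i \<in> I \<Longrightarrow> a i * y = positive_sum (S i)"
    unfolding bchoice_iff by auto
  have "finite (length ` (\<Union>i\<in>I. S i))"
    using assms(1) S(1) by blast
  then obtain M where "\<forall>l\<in>length ` (\<Union>i\<in>I. S i). l \<le> M"
    by (auto simp: finite_nat_set_iff_bounded_le)
  then have M: "length \<alpha> \<le> M" if "i \<in> I" "\<alpha> \<in> S i" for i \<alpha>
    using that by auto
  \<comment> \<open>M bounds the words of all the sets S i at once, so the same suffix, and hence
    the same x, serves every i.\<close>
  let ?\<tau> = "E # replicate M F"
  have "\<exists>\<alpha>. pos_word_star (\<alpha> @ ?\<tau>) * (positive_sum (S i) * pos_word ?\<tau>) = 1" if "i \<in> I" for i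
    by (rule positive_sum_left_inverse) (use S M that in auto)
  then have "\<forall>i\<in>I. \<exists>\<alpha>. pos_word_star (\<alpha> @ ?\<tau>) * (positive_sum (S i) * pos_word ?\<tau>) = 1"
    by (rule ballI)
  then obtain \<alpha> where \<alpha>:
    "\<forall>i\<in>I. pos_word_star (\<alpha> i @ ?\<tau>) * (positive_sum (S i) * pos_word ?\<tau>) = 1"
    unfolding bchoice_iff by (elim exE)
  have "pos_word_star (\<alpha> i @ ?\<tau>) * a i * (y * pos_word ?\<tau>) = 1" if "i \<in> I" for i
    using bspec[OF \<alpha> that] by (simp add: S(3)[OF that, symmetric] mult.assoc)
  then have "\<forall>i\<in>I. \<alpha> i @ ?\<tau> \<noteq> [] \<and> pos_word_star (\<alpha> i @ ?\<tau>) * a i * (y * pos_word ?\<tau>) = 1"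
    by simp
  then show ?thesis by (intro exI)
qed

theorem lemma3p2:
  fixes s :: nat and a :: "nat \<Rightarrow> bit leavitt"
  assumes "\<forall>i\<in>{1..s}. a i \<noteq> 0"
  shows "\<exists>(x :: bit leavitt) (\<eta> :: nat \<Rightarrow> letter list).
    (\<forall>i\<in>{1..s}. \<eta> i \<noteq> [] \<and> pos_word_star (\<eta> i) * a i * x = 1) \<and>
    (\<forall>i\<in>{1..s}.
      right_direct_sum (UNIV :: bit leavitt set)
        (right_multiples (a i * x)) (ker_left_mult (pos_word_star (\<eta> i))) \<and>
      ker_left_mult (pos_word_star (\<eta> i)) \<noteq> {0 :: bit leavitt} \<and>
      (\<exists>B :: bit leavitt set. finite B \<and> B \<subseteq> range pos_word \<and>
        right_basis (ker_left_mult (pos_word_star (\<eta> i))) B))"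
proof -
  obtain x \<eta> where x: "\<forall>i\<in>{1..s}. \<eta> i \<noteq> [] \<and> pos_word_star (\<eta> i) * a i * x = 1"
    using exists_common_right_multiplier[of "{1..s}" a] assms by auto
  have "finite (pos_word ` ({\<gamma>. length \<gamma> = length \<zeta>} - {\<zeta>}) :: bit leavitt set)" for \<zeta>
    by (simp add: finite_letter_lists)
  then have "\<exists>B :: bit leavitt set. finite B \<and> B \<subseteq> range pos_word \<and>
      right_basis (ker_left_mult (pos_word_star \<zeta>)) B" for \<zeta>
    using right_basis_ker_pos_word_star by blast
  \<comment> \<open>Reassociated, the equation for x says that the adjoint of \<eta> i is a left
    inverse of a i * x, which is what the direct sum needs.\<close>
  with x show ?thesis
    by (intro exI[of _ x] exI[of _ \<eta>])
      (simp add: right_direct_sum_ker_left_mult ker_pos_word_star_nonzero mult.assoc)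
qed

end
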